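(* Let $T=T_n\langle i_1,i_2;j_1,j_2\rangle$ (with $i_1<i_2$, $j_1<j_2$) be a Toeplitz matrix with $i_1+j_2=i_2+j_1=n$ and $2(i_1+j_1)\ne n$. Then the row graph of $T$ is a disjoint union of exactly $d$ cycles of length $n/d$, where $d=\gcd(n,i_1+j_1)$.
   Context: Write $[m]=\{1,\dots,m\}$. For disjoint subsets $\alpha=\{i_1<\cdots<i_{k_1}\}$ and $\beta=\{j_1<\cdots<j_{k_2}\}$ of $[n-1]$, not both empty, $T_n\langle\alpha;\beta\rangle=T_n\langle i_1,\ldots,i_{k_1};j_1,\ldots,j_{k_2}\rangle$ denotes the $n\times n$ $(0,1)$-matrix $(t_{u,v})$ with $t_{u,v}=1$ if and only if $u-v\in\alpha$ or $v-u\in\beta$. The row graph $\mathrm{RG}(T)$ of an $n\times n$ $(0,1)$-matrix $T=(t_{u,v})$ is the simple graph with vertex set $[n]$ in which two distinct vertices $u,v$ are adjacent if and only if $t_{u,k}=t_{v,k}=1$ for some $k\in[n]$. *)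

theory Defs
  imports "Jordan_Normal_Form.Matrix" "HOL-Library.Disjoint_Sets"
begin

text \<open>Matrix rows and columns are indexed from 0 in the library; the condition
  below depends only on index differences, so the shift is immaterial here.
  The differences are taken in the integers to avoid truncated subtraction.\<close>

definition toeplitz_mat :: "nat \<Rightarrow> nat set \<Rightarrow> nat set \<Rightarrow> nat mat" where
  "toeplitz_mat n \<alpha> \<beta> =
     mat n n (\<lambda>(u, v).
       if int u - int v \<in> int ` \<alpha> \<or> int v - int u \<in> int ` \<beta> then 1 else 0)"

text \<open>Simple graphs; an edge is a two-element set of vertices.\<close>

record 'a sgraph =
  verts :: "'a set"
  edges :: "'a set set"

text \<open>The vertices are \<open>1, \<dots>, n\<close>; vertex \<open>u\<close> stands for the matrix row with
  0-based index \<open>u - 1\<close>.\<close>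

definition row_graph :: "nat mat \<Rightarrow> nat sgraph" where
  "row_graph T =
     \<lparr> verts = {1..dim_row T},
       edges = {{u, v} | u v. u \<in> {1..dim_row T} \<and> v \<in> {1..dim_row T} \<and> u \<noteq> v \<and>
         (\<exists>k\<in>{1..dim_col T}. T $$ (u - 1, k - 1) = 1 \<and> T $$ (v - 1, k - 1) = 1)} \<rparr>"

definition is_cycle_graph :: "nat \<Rightarrow> 'a sgraph \<Rightarrow> bool" where
  "is_cycle_graph m G \<longleftrightarrow>
     3 \<le> m \<and>
     (\<exists>c. bij_betw c {..<m} (verts G) \<and>
          edges G = {{c i, c (Suc i mod m)} | i. i < m})"

definition is_disjoint_union_of_cycles :: "nat \<Rightarrow> nat \<Rightarrow> 'a sgraph \<Rightarrow> bool" where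
  "is_disjoint_union_of_cycles d m G \<longleftrightarrow>
     (\<exists>C :: nat \<Rightarrow> 'a sgraph.
        (\<forall>i<d. is_cycle_graph m (C i)) \<and>
        disjoint_family_on (\<lambda>i. verts (C i)) {..<d} \<and>
        verts G = (\<Union>i<d. verts (C i)) \<and>
        edges G = (\<Union>i<d. edges (C i)))"

end

theory Submission
  imports Defs "HOL-Number_Theory.Cong"
begin

text \<open>Put \<open>a = i1\<close> and \<open>b = j1\<close>, so that \<open>i2 = n - b\<close> and \<open>j2 = n - a\<close>. The differences
  \<open>a\<close> and \<open>-(n - a)\<close> agree modulo \<open>n\<close>, and so do \<open>-b\<close> and \<open>n - b\<close>. Hence the two lower and
  two upper diagonals of \<open>T\<close> close up to two wrap-around diagonals: \<open>T\<close> is a circulant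
  matrix, and the ones of row \<open>u\<close> are in the columns \<open>u - a\<close> and \<open>u + b\<close> modulo \<open>n\<close>
  (\<open>toeplitz_entry_iff\<close>). Two different rows share a one exactly if the column \<open>u - a\<close> of
  one is the column \<open>v + b\<close> of the other, that is, if \<open>u\<close> and \<open>v\<close> differ by \<open>s = a + b\<close>
  modulo \<open>n\<close> (\<open>row_graph_toeplitz\<close>).

  The row graph is therefore the graph of the translation by \<open>s\<close> on the integers modulo \<open>n\<close>.
  Its components are the cosets of the subgroup generated by \<open>s\<close>; there are \<open>d = gcd n s\<close> of
  them, represented by the residues below \<open>d\<close>, and on each of them the translation is a single
  cycle of length \<open>n / d\<close> (\<open>translation_graph_cycles\<close>). These cycles are proper,
  that is, of length at least 3, since neither \<open>s\<close> nor \<open>2 * s\<close> is divisible by \<open>n\<close>.\<close>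

section \<open>The cycles of a translation modulo n\<close>

text \<open>The walk \<open>r, r + s, r + 2 * s, \<dots>\<close> modulo \<open>n\<close> stays in the residue class of \<open>r\<close>
  modulo \<open>d = gcd n s\<close>, which identifies \<open>r < d\<close>; and it does not repeat a vertex within
  \<open>n / d\<close> steps, because \<open>s / d\<close> is invertible modulo \<open>n / d\<close>.\<close>

lemma translation_walk_inj:
  fixes n s :: nat
  assumes "0 < n"
  shows "inj_on (\<lambda>(r, i). (r + i * s) mod n) ({..<gcd n s} \<times> {..<n div gcd n s})"
proof (rule inj_onI, clarify)
  define d where "d = gcd n s"
  define m where "m = n div d"
  fix r i r' i'
  assume r: "r < gcd n s" "r' < gcd n s" and i: "i < n div gcd n s" "i' < n div gcd n s"
    and eq: "(r + i * s) mod n = (r' + i' * s) mod n"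
  have d: "d dvd n" "d dvd s" "d > 0"
    using assms by (simp_all add: d_def)
  have residue: "(x + k * s) mod n mod d = x" if "x < d" for x k
  proof -
    have "(x + k * s) mod n mod d = (x + k * s) mod d"
      using d(1) by (rule mod_mod_cancel)
    also have "\<dots> = (x + k * s mod d) mod d"
      by (simp add: mod_add_right_eq)
    also have "k * s mod d = 0"
      using d(2) by simp
    finally show ?thesis
      using that by simp
  qed
  have rr: "r = r'"
    using residue[of r i] residue[of r' i'] r eq by (simp add: d_def)
  have "[i * s = i' * s] (mod n)"
    using eq unfolding rr by (simp add: cong_def[symmetric] cong_add_lcancel_nat)
  moreover have "n = m * d" "s = (s div d) * d"
    using d by (simp_all add: m_def)
  ultimately have "[i * (s div d) * d = i' * (s div d) * d] (mod (m * d))"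
    by (metis mult.assoc)
  then have "[i * (s div d) = i' * (s div d)] (mod m)"
    using d(3) by (simp add: cong_def mod_mult_mult2)
  moreover have "coprime (s div d) m"
    using assms by (simp add: d_def m_def div_gcd_coprime coprime_commute)
  ultimately have "[i = i'] (mod m)"
    by (simp add: cong_mult_rcancel_nat)
  then have "i = i'"
    using i by (simp add: cong_def m_def d_def)
  then show "r = r' \<and> i = i'"
    using rr by simp
qed

lemma translation_walk_bij:
  fixes n s :: nat
  assumes "0 < n"
  shows "bij_betw (\<lambda>(r, i). (r + i * s) mod n)
           ({..<gcd n s} \<times> {..<n div gcd n s}) {..<n}"
proof -
  let ?f = "\<lambda>(r, i). (r + i * s) mod n"
  let ?A = "{..<gcd n s} \<times> {..<n div gcd n s}"
  have inj: "inj_on ?f ?A"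
    using translation_walk_inj[OF assms] .
  have "?f ` ?A \<subseteq> {..<n}"
    using assms by auto
  moreover have "card (?f ` ?A) = card {..<n}"
    by (simp add: card_image[OF inj] card_cartesian_product)
  ultimately have "?f ` ?A = {..<n}"
    by (simp add: card_subset_eq)
  with inj show ?thesis
    by (simp add: bij_betw_def)
qed

text \<open>The cycle through \<open>r\<close> closes up after \<open>n / d\<close> steps, since \<open>(n / d) * s\<close> is a
  multiple of \<open>n\<close>; so each of its edges is a translation by \<open>s\<close>. Conversely, the walks
  cover every residue, hence also every edge.\<close>

lemma translation_graph_cycles:
  fixes n s :: nat
  assumes "3 \<le> n div gcd n s"
    and verts: "verts G = {1..n}"
    and edges: "edges G = {{Suc u, Suc ((u + s) mod n)} | u. u < n}"
  shows "is_disjoint_union_of_cycles (gcd n s) (n div gcd n s) G"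
proof -
  define d where "d = gcd n s"
  define m where "m = n div d"
  define w where "w = (\<lambda>r i. (r + i * s) mod n)"
  define C :: "nat \<Rightarrow> nat sgraph" where
    "C = (\<lambda>r. \<lparr>verts = (\<lambda>i. Suc (w r i)) ` {..<m},
               edges = {{Suc (w r i), Suc (w r (Suc i mod m))} | i. i < m}\<rparr>)"
  have n: "0 < n" and m: "3 \<le> m"
    using assms(1) by (auto simp: m_def d_def intro: Nat.gr0I)
  have bij: "bij_betw (\<lambda>(r, i). w r i) ({..<d} \<times> {..<m}) {..<n}"
    using translation_walk_bij[OF n, of s] by (simp add: w_def d_def m_def)
  then have inj: "r = r' \<and> i = i'"
    if "w r i = w r' i'" "r < d" "r' < d" "i < m" "i' < m" for r r' i i'
    using that by (auto simp: bij_betw_def inj_on_def)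
  have surj: "\<exists>r<d. \<exists>i<m. u = w r i" if "u < n" for u
  proof -
    have "u \<in> (\<lambda>(r, i). w r i) ` ({..<d} \<times> {..<m})"
      using bij that by (simp add: bij_betw_def)
    then show ?thesis by auto
  qed
  have less: "w r i < n" for r i
    using n by (simp add: w_def)
  have "m * s = n * (s div d)"
  proof -
    have "m * s = m * (d * (s div d))"
      by (simp add: d_def)
    also have "\<dots> = (m * d) * (s div d)"
      by (simp only: mult.assoc)
    also have "m * d = n"
      by (simp add: m_def d_def)
    finally show ?thesis .
  qed
  then have close: "w r m = w r 0" for r
    by (simp add: w_def)
  have step: "w r (Suc i mod m) = (w r i + s) mod n" if "i < m" for r i
  proof -
    have "w r (Suc i mod m) = w r (Suc i)"
      using that close[of r] by (cases "Suc i = m") auto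
    then show ?thesis
      by (simp add: w_def mod_simps ac_simps)
  qed
  have "is_cycle_graph m (C r)" if "r < d" for r
  proof -
    have "inj_on (\<lambda>i. Suc (w r i)) {..<m}"
    proof (rule inj_onI)
      fix i i' assume "i \<in> {..<m}" "i' \<in> {..<m}" "Suc (w r i) = Suc (w r i')"
      then show "i = i'"
        using inj[of r i r i'] that by simp
    qed
    then have "bij_betw (\<lambda>i. Suc (w r i)) {..<m} (verts (C r))"
      by (simp add: bij_betw_def C_def)
    then show ?thesis
      using m by (auto simp: is_cycle_graph_def C_def intro!: exI[of _ "\<lambda>i. Suc (w r i)"])
  qed
  moreover have "disjoint_family_on (\<lambda>r. verts (C r)) {..<d}"
    unfolding disjoint_family_on_def
  proof (intro ballI impI)
    fix r r' assume "r \<in> {..<d}" "r' \<in> {..<d}" "r \<noteq> r'"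
    then have "w r i \<noteq> w r' i'" if "i < m" "i' < m" for i i'
      using inj[of r i r' i'] that by auto
    then show "verts (C r) \<inter> verts (C r') = {}"
      by (auto simp: C_def)
  qed
  moreover have "verts G = (\<Union>r<d. verts (C r))"
  proof
    show "verts G \<subseteq> (\<Union>r<d. verts (C r))"
    proof
      fix v assume "v \<in> verts G"
      then obtain u where u: "v = Suc u" "u < n"
        using verts by (cases v) auto
      then show "v \<in> (\<Union>r<d. verts (C r))"
        using surj[of u] by (auto simp: C_def)
    qed
    show "(\<Union>r<d. verts (C r)) \<subseteq> verts G"
      using less by (auto simp: C_def verts Suc_le_eq)
  qed
  moreover have "edges G = (\<Union>r<d. edges (C r))"
  proof
    show "edges G \<subseteq> (\<Union>r<d. edges (C r))"
    proof
      fix e assume "e \<in> edges G"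
      then obtain u where u: "u < n" "e = {Suc u, Suc ((u + s) mod n)}"
        using edges by auto
      obtain r i where ri: "r < d" "i < m" "u = w r i"
        using surj[OF u(1)] by blast
      then have "e = {Suc (w r i), Suc (w r (Suc i mod m))}"
        using u step by simp
      then show "e \<in> (\<Union>r<d. edges (C r))"
        using ri by (auto simp: C_def)
    qed
    show "(\<Union>r<d. edges (C r)) \<subseteq> edges G"
      using less step by (fastforce simp: C_def edges)
  qed
  ultimately show ?thesis
    unfolding is_disjoint_union_of_cycles_def d_def[symmetric] m_def[symmetric] by blast
qed

text \<open>A translation of order 1 or 2 would have \<open>s\<close> or \<open>2 * s\<close> divisible by \<open>n\<close>, and the only
  multiple of \<open>n\<close> strictly between \<open>0\<close> and \<open>2 * n\<close> is \<open>n\<close> itself.\<close>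

lemma translation_order_ge_3:
  fixes n s :: nat
  assumes "0 < s" "s < n" "2 * s \<noteq> n"
  shows "3 \<le> n div gcd n s"
proof (rule ccontr)
  define d where "d = gcd n s"
  obtain m where n: "n = d * m"
    using gcd_dvd1[of n s] unfolding d_def by (rule dvdE)
  obtain q where s: "s = d * q"
    using gcd_dvd2[of n s] unfolding d_def by (rule dvdE)
  assume "\<not> 3 \<le> n div gcd n s"
  moreover have "n div gcd n s = m"
    using assms n by (metis d_def mult_eq_0_iff nonzero_mult_div_cancel_left not_less0)
  ultimately have "m < 3"
    by simp
  moreover have "0 < q" "q < m" "2 * q \<noteq> m"
    using assms n s by auto
  ultimately show False
    by linarith
qed

section \<open>Toeplitz matrices with wrap-around diagonals\<close>

text \<open>The diagonals \<open>a\<close> and \<open>-(n - a)\<close> together make up one wrap-around diagonal, and so do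
  \<open>n - b\<close> and \<open>-b\<close>. Each of the two is written as an equation without subtraction.\<close>

lemma toeplitz_entry_iff:
  assumes "a \<le> n" "b \<le> n" "u < n" "k < n"
  shows "toeplitz_mat n {a, n - b} {b, n - a} $$ (u, k) = 1 \<longleftrightarrow>
           u = (k + a) mod n \<or> k = (u + b) mod n"
proof -
  have wrap: "(x + y) mod n = (if x + y < n then x + y else x + y - n)"
    if "x < n" "y \<le> n" for x y :: nat
    using that by (auto simp: mod_if)
  show ?thesis
    using assms by (auto simp: toeplitz_mat_def wrap)
qed

text \<open>Rows \<open>u \<noteq> v\<close> cannot share a one on the same wrap-around diagonal, as a column meets
  each diagonal once. On different diagonals, the common column \<open>k\<close> has
  \<open>u = k + a\<close> and \<open>k = v + b\<close> modulo \<open>n\<close>, so that \<open>u = v + (a + b)\<close>.\<close>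

lemma row_graph_toeplitz:
  fixes n a b :: nat
  assumes "0 < a + b" "a + b < n"
  defines "G \<equiv> row_graph (toeplitz_mat n {a, n - b} {b, n - a})"
  shows "verts G = {1..n}"
    and "edges G = {{Suc u, Suc ((u + (a + b)) mod n)} | u. u < n}"
proof -
  let ?T = "toeplitz_mat n {a, n - b} {b, n - a}"
  have dim: "dim_row ?T = n" "dim_col ?T = n"
    by (simp_all add: toeplitz_mat_def)
  show "verts G = {1..n}"
    by (simp add: G_def row_graph_def dim)
  have entry: "?T $$ (u, k) = 1 \<longleftrightarrow> u = (k + a) mod n \<or> k = (u + b) mod n"
    if "u < n" "k < n" for u k
    using toeplitz_entry_iff[of a n b u k] that assms by simp
  have shift: "(k + a) mod n = (v + (a + b)) mod n" if "k = (v + b) mod n" for k v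
    using that by (simp add: mod_simps ac_simps)
  show "edges G = {{Suc u, Suc ((u + (a + b)) mod n)} | u. u < n}" (is "_ = ?E")
  proof
    show "edges G \<subseteq> ?E"
    proof
      fix e assume "e \<in> edges G"
      then obtain u' v' k' where e: "e = {u', v'}" "u' \<noteq> v'"
        and range: "u' \<in> {1..n}" "v' \<in> {1..n}" "k' \<in> {1..n}"
        and T: "?T $$ (u' - 1, k' - 1) = 1" "?T $$ (v' - 1, k' - 1) = 1"
        unfolding G_def row_graph_def dim by auto
      define u v k where "u = u' - 1" and "v = v' - 1" and "k = k' - 1"
      have uv: "u < n" "v < n" "k < n" "u' = Suc u" "v' = Suc v" "u \<noteq> v"
        using range e(2) by (auto simp: u_def v_def k_def)
      have ones: "u = (k + a) mod n \<or> k = (u + b) mod n" "v = (k + a) mod n \<or> k = (v + b) mod n"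
        using T[folded u_def v_def k_def] entry[OF uv(1,3)] entry[OF uv(2,3)] by blast+
      have "\<not> (k = (u + b) mod n \<and> k = (v + b) mod n)"
      proof
        assume "k = (u + b) mod n \<and> k = (v + b) mod n"
        then have "[u + b = v + b] (mod n)"
          by (simp add: cong_def)
        then have "[u = v] (mod n)"
          by (simp add: cong_add_rcancel_nat)
        then show False
          using uv by (simp add: cong_def)
      qed
      then have "u = (v + (a + b)) mod n \<or> v = (u + (a + b)) mod n"
        using ones shift uv(6) by metis
      then show "e \<in> ?E"
        using e(1) uv by (auto simp: insert_commute)
    qed
    show "?E \<subseteq> edges G"
    proof
      fix e assume "e \<in> ?E"
      then obtain v where v: "v < n" "e = {Suc v, Suc ((v + (a + b)) mod n)}"
        by blast
      define u where "u = (v + (a + b)) mod n"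
      define k where "k = (v + b) mod n"
      have less: "u < n" "k < n"
        using v(1) by (simp_all add: u_def k_def)
      have "v \<noteq> u"
        using assms v(1) by (auto simp: u_def mod_if)
      moreover have "?T $$ (v, k) = 1" "?T $$ (u, k) = 1"
        using entry v(1) less shift[OF k_def] by (simp_all add: k_def u_def)
      ultimately show "e \<in> edges G"
        using v less unfolding G_def row_graph_def dim u_def[symmetric]
        by (simp, intro exI[of _ "Suc v"] exI[of _ "Suc u"] conjI bexI[of _ "Suc k"]) simp_all
    qed
  qed
qed

theorem theorem3p15:
  fixes n i1 i2 j1 j2 :: nat
  assumes "{i1, i2} \<subseteq> {1..n - 1}" and "{j1, j2} \<subseteq> {1..n - 1}"
    and "{i1, i2} \<inter> {j1, j2} = {}"
    and "i1 < i2" and "j1 < j2"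
    and "i1 + j2 = n" and "i2 + j1 = n"
    and "2 * (i1 + j1) \<noteq> n"
  shows "is_disjoint_union_of_cycles (gcd n (i1 + j1)) (n div gcd n (i1 + j1))
           (row_graph (toeplitz_mat n {i1, i2} {j1, j2}))"
proof -
  have s: "0 < i1 + j1" "i1 + j1 < n"
    using assms by auto
  have "i2 = n - j1" "j2 = n - i1"
    using assms by auto
  then show ?thesis
    using translation_graph_cycles[OF translation_order_ge_3[OF s assms(8)]
        row_graph_toeplitz[OF s]]
    by simp
qed

end
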